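(* The set of divisors of zero in $\mathbb{B}$ is the union of the set of non-zero complex multiples of the non-trivial idempotents and the set of non-zero nilpotents: $$\{p\in\mathbb{B}: p\neq 0,\ \|p\|=0\}=\{\alpha q:\alpha\in\mathbb{C},\ \alpha\ne0,\ q\in\mathbb{B},\ q^2=q,\ q\neq 0,\ q\neq 1\}\cup\{p\in\mathbb{B}:p\neq0,\ p^2=0\}.$$
   Context: $\mathbb{B}$ denotes the algebra of biquaternions (quaternions with complex coefficients), whose elements are $q=W+X\boldsymbol{i}+Y\boldsymbol{j}+Z\boldsymbol{k}$ with $W,X,Y,Z\in\mathbb{C}$, where $\boldsymbol{i},\boldsymbol{j},\boldsymbol{k}$ are the usual quaternion units and complex scalars commute with all biquaternions. The semi-norm is $\|q\|=W^2+X^2+Y^2+Z^2\in\mathbb{C}$. A divisor of zero is a non-zero biquaternion $q$ with $\|q\|=0$. An idempotent is an element $q$ with $q^2=q$ (the trivial ones being $0$ and $1$), and a nilpotent is an element $q$ with $q^2=0$. *)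

theory Defs
  imports Complex_Main
begin

datatype biquaternion =
  Biquaternion (bqW: complex) (bqX: complex) (bqY: complex) (bqZ: complex)

lemma biquaternion_eq_iff:
  "p = q \<longleftrightarrow> bqW p = bqW q \<and> bqX p = bqX q \<and> bqY p = bqY q \<and> bqZ p = bqZ q"
  by (cases p; cases q) simp

instantiation biquaternion :: ring_1
begin

definition "0 = Biquaternion 0 0 0 0"

definition "1 = Biquaternion 1 0 0 0"

definition "p + q =
  Biquaternion (bqW p + bqW q) (bqX p + bqX q) (bqY p + bqY q) (bqZ p + bqZ q)"

definition "- p = Biquaternion (- bqW p) (- bqX p) (- bqY p) (- bqZ p)"

definition "p - q =
  Biquaternion (bqW p - bqW q) (bqX p - bqX q) (bqY p - bqY q) (bqZ p - bqZ q)"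

text \<open>Hamilton's product, extended complex-bilinearly.\<close>

definition "p * q = Biquaternion
  (bqW p * bqW q - bqX p * bqX q - bqY p * bqY q - bqZ p * bqZ q)
  (bqW p * bqX q + bqX p * bqW q + bqY p * bqZ q - bqZ p * bqY q)
  (bqW p * bqY q - bqX p * bqZ q + bqY p * bqW q + bqZ p * bqX q)
  (bqW p * bqZ q + bqX p * bqY q - bqY p * bqX q + bqZ p * bqW q)"

instance
  by standard
    (simp_all add: zero_biquaternion_def one_biquaternion_def plus_biquaternion_def
      uminus_biquaternion_def minus_biquaternion_def times_biquaternion_def
      algebra_simps)

end

definition scaleBQ :: "complex \<Rightarrow> biquaternion \<Rightarrow> biquaternion" (infixr \<open>*\<^sub>B\<close> 75) where
  "a *\<^sub>B q = Biquaternion (a * bqW q) (a * bqX q) (a * bqY q) (a * bqZ q)"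

definition bq_i :: biquaternion where "bq_i = Biquaternion 0 1 0 0"
definition bq_j :: biquaternion where "bq_j = Biquaternion 0 0 1 0"
definition bq_k :: biquaternion where "bq_k = Biquaternion 0 0 0 1"

text \<open>The semi-norm is complex-valued and uses no complex conjugation of the coefficients.\<close>

definition bq_seminorm :: "biquaternion \<Rightarrow> complex" where
  "bq_seminorm q = (bqW q)\<^sup>2 + (bqX q)\<^sup>2 + (bqY q)\<^sup>2 + (bqZ q)\<^sup>2"

lemmas biquaternion_defs =
  zero_biquaternion_def one_biquaternion_def plus_biquaternion_def
  uminus_biquaternion_def minus_biquaternion_def times_biquaternion_def
  scaleBQ_def bq_i_def bq_j_def bq_k_def

lemma biquaternion_expand:
  "Biquaternion W X Y Z = W *\<^sub>B 1 + X *\<^sub>B bq_i + Y *\<^sub>B bq_j + Z *\<^sub>B bq_k"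
  by (simp add: biquaternion_defs)

lemma biquaternion_units:
  "bq_i * bq_i = - 1" "bq_j * bq_j = - 1" "bq_k * bq_k = - 1"
  "bq_i * bq_j = bq_k" "bq_j * bq_k = bq_i" "bq_k * bq_i = bq_j"
  "bq_j * bq_i = - bq_k" "bq_k * bq_j = - bq_i" "bq_i * bq_k = - bq_j"
  by (simp_all add: biquaternion_defs)

lemma scaleBQ_mult:
  "(a *\<^sub>B p) * q = a *\<^sub>B (p * q)" "p * (a *\<^sub>B q) = a *\<^sub>B (p * q)"
  by (simp_all add: biquaternion_defs algebra_simps)

lemma scaleBQ_module: "module scaleBQ"
  by standard (simp_all add: biquaternion_defs algebra_simps)

end

(* Every biquaternion p = W + X i + Y j + Z k satisfies its characteristic equation
   p^2 = 2 W p - ||p||.  Hence for ||p|| = 0 either W = 0 and p is nilpotent, or p / (2 W) is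
   idempotent.  Conversely, ||p|| \<noteq> 0 makes p left cancellable (multiply by the conjugate), while
   a non-trivial idempotent or non-zero nilpotent q is not, since q (q - 1) = 0 or q q = 0. *)

theory Submission
  imports Defs
begin

text \<open>This is Cayley-Hamilton: with biquaternions viewed as 2 by 2 complex matrices,
  \<open>2 * bqW p\<close> is the trace and \<open>bq_seminorm p\<close> the determinant.\<close>

lemma biquaternion_square:
  "p\<^sup>2 = (2 * bqW p) *\<^sub>B p - bq_seminorm p *\<^sub>B 1"
  by (simp add: biquaternion_eq_iff biquaternion_defs bq_seminorm_def power2_eq_square
      algebra_simps)

lemma scaleBQ_eq_0_iff: "a *\<^sub>B p = 0 \<longleftrightarrow> a = 0 \<or> p = 0"
  by (auto simp: biquaternion_eq_iff biquaternion_defs)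

lemma scaleBQ_scaleBQ: "a *\<^sub>B b *\<^sub>B p = (a * b) *\<^sub>B p"
  by (simp add: biquaternion_defs)

lemma scaleBQ_one: "1 *\<^sub>B p = p"
  by (simp add: biquaternion_eq_iff biquaternion_defs)

lemma bq_seminorm_scaleBQ: "bq_seminorm (a *\<^sub>B p) = a\<^sup>2 * bq_seminorm p"
  by (simp add: biquaternion_defs bq_seminorm_def power_mult_distrib algebra_simps)

lemma mult_eq_0_imp_bq_seminorm_eq_0:
  fixes p r :: biquaternion
  assumes "p * r = 0" "r \<noteq> 0"
  shows "bq_seminorm p = 0"
proof -
  \<comment> \<open>The quaternion conjugate: the vector part changes sign, while the complex
    coefficients are not conjugated.\<close>
  let ?c = "Biquaternion (bqW p) (- bqX p) (- bqY p) (- bqZ p)"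
  have "?c * p = bq_seminorm p *\<^sub>B 1"
    by (simp add: biquaternion_defs bq_seminorm_def power2_eq_square algebra_simps)
  then have "bq_seminorm p *\<^sub>B r = ?c * (p * r)"
    by (simp add: scaleBQ_mult flip: mult.assoc)
  with assms show ?thesis
    by (simp add: scaleBQ_eq_0_iff)
qed

lemma idempotent_bq_seminorm:
  assumes "q\<^sup>2 = q" "q \<noteq> 1"
  shows "bq_seminorm q = 0"
  using mult_eq_0_imp_bq_seminorm_eq_0[of q "q - 1"] assms
  by (simp add: right_diff_distrib power2_eq_square)

lemma nilpotent_bq_seminorm:
  assumes "q\<^sup>2 = 0" "q \<noteq> 0"
  shows "bq_seminorm q = 0"
  using mult_eq_0_imp_bq_seminorm_eq_0[of q q] assms by (simp add: power2_eq_square)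

lemma zero_divisor_cases:
  assumes "p \<noteq> 0" "bq_seminorm p = 0"
  shows "(\<exists>\<alpha> q. p = \<alpha> *\<^sub>B q \<and> \<alpha> \<noteq> 0 \<and> q\<^sup>2 = q \<and> q \<noteq> 0 \<and> q \<noteq> 1) \<or> p\<^sup>2 = 0"
proof (cases "bqW p = 0")
  case True
  \<comment> \<open>Both terms on the right of the characteristic equation vanish.\<close>
  with assms have "p\<^sup>2 = 0"
    by (simp add: biquaternion_square[of p] biquaternion_defs)
  then show ?thesis ..
next
  case False
  \<comment> \<open>Dividing by the trace gives \<open>q\<close> trace 1, so with semi-norm 0 its
    characteristic equation reads \<open>q\<^sup>2 = q\<close>.\<close>
  define \<alpha> where "\<alpha> = 2 * bqW p"
  define q where "q = inverse \<alpha> *\<^sub>B p"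
  have \<alpha>: "\<alpha> \<noteq> 0" using False by (simp add: \<alpha>_def)
  have norm: "bq_seminorm q = 0"
    by (simp add: q_def bq_seminorm_scaleBQ assms)
  have "2 * bqW q = 1"
    using False by (simp add: q_def \<alpha>_def scaleBQ_def)
  then have "q\<^sup>2 = q"
    using norm by (simp add: biquaternion_square[of q] scaleBQ_one)
      (simp add: biquaternion_eq_iff biquaternion_defs)
  moreover have "p = \<alpha> *\<^sub>B q"
    using \<alpha> by (simp add: q_def scaleBQ_scaleBQ scaleBQ_one)
  moreover have "q \<noteq> 0"
    using \<alpha> assms by (simp add: q_def scaleBQ_eq_0_iff)
  \<comment> \<open>The semi-norm of 1 is 1, whereas that of \<open>q\<close> is 0.\<close>
  moreover have "q \<noteq> 1"
    using norm by (auto simp: bq_seminorm_def one_biquaternion_def)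
  ultimately show ?thesis using \<alpha> by blast
qed

theorem mainTheorem5:
  shows "{p :: biquaternion. p \<noteq> 0 \<and> bq_seminorm p = 0} =
    {\<alpha> *\<^sub>B q | (\<alpha> :: complex) (q :: biquaternion). \<alpha> \<noteq> 0 \<and> q\<^sup>2 = q \<and> q \<noteq> 0 \<and> q \<noteq> 1} \<union>
    {p :: biquaternion. p \<noteq> 0 \<and> p\<^sup>2 = 0}"
  (is "?D = ?I \<union> ?N")
proof
  show "?D \<subseteq> ?I \<union> ?N"
    using zero_divisor_cases by blast
  show "?I \<union> ?N \<subseteq> ?D"
    \<comment> \<open>Scaling by \<alpha> multiplies the semi-norm by the square of \<alpha>, so
      multiples of an idempotent inherit semi-norm 0.\<close>
    using idempotent_bq_seminorm nilpotent_bq_seminorm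
    by (auto simp: scaleBQ_eq_0_iff bq_seminorm_scaleBQ)
qed

end
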